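(* Let $N\ge 1$, $1\le s\le N$ and $r$ be integers, and let $t,\Delta$ be generic complex parameters. Define the rational function $$\mathcal J(z_1,\dots,z_s)=\prod_{j=1}^{s}\frac{(t^2-2\Delta t+z_j)^{s-j}}{z_j^{N-r}(z_j-1)^{s-j+1}}\prod_{1\le j<k\le s}\frac{z_j-z_k}{t^2-2\Delta t z_k+z_jz_k}\;\tilde h_{N,s}(z_1,\dots,z_s).$$ Then the iterated residue at $z=1$, taken first in $z_s$, then in $z_{s-1}$, ..., finally in $z_1$, equals one: $$\operatorname*{res}_{z_1=1}\operatorname*{res}_{z_2=1}\cdots\operatorname*{res}_{z_s=1}\mathcal J(z_1,\dots,z_s)=1.$$
   Context: Define functions $\phi_j(t)$ by $\phi_0\equiv1$ and $\phi_{j+1}(t)=t\frac{d}{dt}\big[(t-2\Delta+t^{-1})\phi_j(t)\big]$. For $N\ge1$ the polynomial $h_N(z)=h_N(z;t,\Delta)$ (of degree $N-1$ in $z$, with $h_N(1)=1$) is $$h_N(z)=(N-1)!\Big((t-2\Delta+t^{-1})\frac{z}{z-1}\Big)^{N-1}\frac{\det\big[M_{ij}\big]_{i,j=1}^N}{\det[\phi_{i+j-2}(t)]_{i,j=1}^N},$$ where $M_{ij}=\phi_{i+j-2}(t)$ for $j=1,\dots,N-1$ and $M_{iN}=\phi_{i-1}(tz)$. (It is the generating function $h_N(z)=\sum_{r=1}^N H_N^{(r)}z^{r-1}$ of the boundary one-point correlation function of the six-vertex model with domain wall boundary conditions, $\Delta=(a^2+b^2-c^2)/(2ab)$, $t=b/a$.)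 Let $\tilde h_N(z)=z^{N-1}h_N(z^{-1})$ and, for $1\le s\le N$, $$\tilde h_{N,s}(z_1,\dots,z_s)=\frac{\det\big[(z_j-1)^{s-i}z_j^{i-1}\tilde h_{N-i+1}(z_j)\big]_{i,j=1}^{s}}{\prod_{1\le i<j\le s}(z_i-z_j)},$$ a symmetric polynomial. *)

theory Defs
  imports "HOL-Complex_Analysis.Complex_Analysis"
          "HOL-Computational_Algebra.Polynomial"
          "Jordan_Normal_Form.Determinant"
begin

fun phi :: "complex \<Rightarrow> nat \<Rightarrow> complex \<Rightarrow> complex" where
  "phi \<Delta> 0 = (\<lambda>t. 1)"
| "phi \<Delta> (Suc j) = (\<lambda>t. t * deriv (\<lambda>u. (u - 2 * \<Delta> + inverse u) * phi \<Delta> j u) t)"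

definition hN :: "complex \<Rightarrow> complex \<Rightarrow> nat \<Rightarrow> complex \<Rightarrow> complex" where
  "hN t \<Delta> N z =
     fact (N - 1) * ((t - 2 * \<Delta> + inverse t) * (z / (z - 1))) ^ (N - 1) *
     Determinant.det (Matrix.mat N N (\<lambda>(i, j). if j < N - 1 then phi \<Delta> (i + j) t else phi \<Delta> i (t * z)))
     / Determinant.det (Matrix.mat N N (\<lambda>(i, j). phi \<Delta> (i + j) t))"

definition htilde :: "complex \<Rightarrow> complex \<Rightarrow> nat \<Rightarrow> complex \<Rightarrow> complex" where
  "htilde t \<Delta> N z = z ^ (N - 1) * hN t \<Delta> N (inverse z)"

definition htilde_s :: "complex \<Rightarrow> complex \<Rightarrow> nat \<Rightarrow> nat \<Rightarrow> complex list \<Rightarrow> complex" where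
  "htilde_s t \<Delta> N s zs =
     Determinant.det (Matrix.mat s s (\<lambda>(i, j). (zs ! j - 1) ^ (s - 1 - i) * (zs ! j) ^ i * htilde t \<Delta> (N - i) (zs ! j)))
     / (\<Prod>i<s. \<Prod>j\<in>{i<..<s}. (zs ! i - zs ! j))"

definition Jfun :: "complex \<Rightarrow> complex \<Rightarrow> nat \<Rightarrow> int \<Rightarrow> nat \<Rightarrow> complex list \<Rightarrow> complex" where
  "Jfun t \<Delta> N r s zs =
     (\<Prod>j<s. (t ^ 2 - 2 * \<Delta> * t + zs ! j) ^ (s - 1 - j)
              / ((zs ! j) powi (int N - r) * (zs ! j - 1) ^ (s - j)))
   * (\<Prod>j<s. \<Prod>k\<in>{j<..<s}. (zs ! j - zs ! k) / (t ^ 2 - 2 * \<Delta> * t * zs ! k + zs ! j * zs ! k))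
   * htilde_s t \<Delta> N s zs"

text \<open>Iterated residue at 1: iter_res s F [] = res_(z_1=1) ... res_(z_s=1) F [z_1,...,z_s],
  the residue in the last variable z_s being taken first.\<close>
fun iter_res :: "nat \<Rightarrow> (complex list \<Rightarrow> complex) \<Rightarrow> complex list \<Rightarrow> complex" where
  "iter_res 0 F = F"
| "iter_res (Suc k) F = iter_res k (\<lambda>zs. residue (\<lambda>w. F (zs @ [w])) 1)"

end

theory Submission
  imports Defs
begin

text \<open>
  For generic \<open>(t, \<Delta>)\<close> every \<open>htilde\<^sub>n\<close> extends holomorphically across \<open>z = 1\<close> with value 1.
  With \<open>v = 1/z\<close>, the numerator determinant \<open>D\<^sub>0(v)\<close> of \<open>h\<^sub>n(v)\<close> vanishes to order \<open>n - 1\<close>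
  at \<open>v = 1\<close>, cancelling the pole of \<open>(v/(v - 1))\<^sup>n\<^sup>-\<^sup>1\<close>: if \<open>D\<^sub>m\<close> denotes the Hankel determinant
  \<open>det[\<phi>\<^sub>i\<^sub>+\<^sub>j(t)]\<close> with last column replaced by \<open>\<phi>\<^sub>i\<^sub>+\<^sub>m(tv)\<close>, then
  \<open>((tv - 2\<Delta> + 1/(tv)) D\<^sub>m(v))' = D\<^sub>m\<^sub>+\<^sub>1(v)/v\<close>, and \<open>D\<^sub>m(1) = 0\<close> for \<open>m < n - 1\<close> because
  two columns coincide, so each integration raises the order of the zero by one.

  After cancelling the Vandermonde denominator of \<open>htilde\<^sub>N\<^sub>,\<^sub>s\<close> against the factors
  \<open>z\<^sub>j - z\<^sub>k\<close> of \<open>J\<close>, the residue in the last variable only sees the bottom entry of the last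
  column, whose cofactor is the same determinant in one variable less; all other factors equal 1
  at \<open>z\<^sub>s = 1\<close>, so the iterated residue telescopes to 1.

  Genericity is the non-vanishing of \<open>t\<close>, of \<open>t\<^sup>2 - 2\<Delta>t + 1\<close> and of the Hankel determinants;
  after clearing powers of \<open>t\<close> the latter are polynomials in \<open>(\<Delta>, t)\<close>, and at \<open>(0, 0)\<close> they
  become \<open>det[(-1)\<^sup>i\<^sup>+\<^sup>j (i + j)!] \<noteq> 0\<close>.
\<close>

section \<open>The functions \<open>\<phi>\<^sub>j\<close>\<close>

declare phi.simps(2) [simp del]

lemma phi_holomorphic: "phi \<Delta> j holomorphic_on -{0}"
proof (induction j)
  case 0
  then show ?case by simp
next
  case (Suc j)
  have "(\<lambda>u. (u - 2 * \<Delta> + inverse u) * phi \<Delta> j u) holomorphic_on -{0}"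
    using Suc by (intro holomorphic_intros) auto
  then have "deriv (\<lambda>u. (u - 2 * \<Delta> + inverse u) * phi \<Delta> j u) holomorphic_on -{0}"
    by (rule holomorphic_deriv) (auto simp: open_Compl)
  then show ?case
    unfolding phi.simps(2) by (auto intro!: holomorphic_intros)
qed

lemma phi_Suc_has_field_derivative:
  assumes "u \<noteq> 0"
  shows "((\<lambda>u. (u - 2 * \<Delta> + inverse u) * phi \<Delta> j u) has_field_derivative phi \<Delta> (Suc j) u / u) (at u)"
proof -
  let ?G = "\<lambda>u. (u - 2 * \<Delta> + inverse u) * phi \<Delta> j u"
  have "?G holomorphic_on -{0}"
    using phi_holomorphic by (intro holomorphic_intros) auto
  then have "(?G has_field_derivative deriv ?G u) (at u)"
    using assms by (meson DERIV_deriv_iff_field_differentiable holomorphic_on_imp_differentiable_at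
        open_Compl closed_singleton ComplI singletonD)
  moreover have "deriv ?G u = phi \<Delta> (Suc j) u / u"
    using assms by (simp add: phi.simps(2))
  ultimately show ?thesis by simp
qed

text \<open>Since \<open>u - 2\<Delta> + 1/u = [:1, -2\<Delta>, 1:](u) / u\<close> and
  \<open>u (q(u) / u\<^sup>j\<^sup>+\<^sup>1)' = (u q'(u) - (j+1) q(u)) / u\<^sup>j\<^sup>+\<^sup>1\<close>, the function \<open>u\<^sup>j \<phi>\<^sub>j(u)\<close> is a polynomial.\<close>
fun phi_numerator :: "complex \<Rightarrow> nat \<Rightarrow> complex poly" where
  "phi_numerator \<Delta> 0 = 1"
| "phi_numerator \<Delta> (Suc j) = pCons 0 (pderiv ([:1, -2*\<Delta>, 1:] * phi_numerator \<Delta> j))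
      - Polynomial.smult (of_nat (Suc j)) ([:1, -2*\<Delta>, 1:] * phi_numerator \<Delta> j)"

lemma poly_phi_numerator: "u \<noteq> 0 \<Longrightarrow> poly (phi_numerator \<Delta> j) u = u ^ j * phi \<Delta> j u"
proof (induction j arbitrary: u)
  case 0
  then show ?case by simp
next
  case (Suc j)
  define q where "q = [:1, -2*\<Delta>, 1:] * phi_numerator \<Delta> j"
  define w where "w = u ^ j"
  have u: "u \<noteq> 0" and w: "w \<noteq> 0"
    using Suc.prems by (simp_all add: w_def)
  let ?G = "\<lambda>u. (u - 2 * \<Delta> + inverse u) * phi \<Delta> j u"
  let ?F = "\<lambda>v. poly q v / v ^ Suc j"
  let ?F' = "(poly (pderiv q) u * u ^ Suc j - poly q u * (of_nat (Suc j) * u ^ j)) / (u ^ Suc j * u ^ Suc j)"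
  have "(?F has_field_derivative ?F') (at u)"
    using u DERIV_power[OF DERIV_ident, of "Suc j" u] by (intro DERIV_divide poly_DERIV) auto
  then have "(?G has_field_derivative ?F') (at u)"
  proof (rule has_field_derivative_transform_within_open)
    show "open (-{0::complex})"
      by (simp add: open_Compl)
    show "?F v = ?G v" if "v \<in> -{0}" for v
      using that Suc.IH[of v] by (simp add: q_def field_simps power2_eq_square)
  qed (use u in simp)
  then have "phi \<Delta> (Suc j) u / u = ?F'"
    using DERIV_unique[OF phi_Suc_has_field_derivative[OF u]] by blast
  also have "?F' = (u * poly (pderiv q) u - of_nat (Suc j) * poly q u) / (u * (u * w))"
    using u w by (simp add: w_def[symmetric] power_Suc divide_simps) (simp add: algebra_simps)
  finally show ?case
    using u w by (simp add: q_def w_def[symmetric] power_Suc divide_simps mult.commute)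
qed

lemma poly_phi_numerator_0: "poly (phi_numerator \<Delta> j) 0 = (-1) ^ j * fact j"
proof (induction j)
  case 0
  then show ?case by simp
next
  case (Suc j)
  have "poly (phi_numerator \<Delta> (Suc j)) 0 = - (of_nat (Suc j) * poly (phi_numerator \<Delta> j) 0)"
    by (simp only: phi_numerator.simps poly_diff poly_pCons poly_smult poly_mult) simp
  then show ?case
    using Suc.IH by (simp del: phi_numerator.simps)
qed

lemma degree_phi_numerator: "degree (phi_numerator \<Delta> j) \<le> 2 * j"
proof (induction j)
  case 0
  then show ?case by simp
next
  case (Suc j)
  let ?q = "[:1, -2*\<Delta>, 1:] * phi_numerator \<Delta> j"
  have "degree ?q \<le> 2 * Suc j"
    using degree_mult_le[of "[:1, -2*\<Delta>, 1:]" "phi_numerator \<Delta> j"] Suc.IH by simp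
  then show ?case
    by (simp only: phi_numerator.simps)
       (intro degree_diff_le order_trans[OF degree_smult_le] order_trans[OF degree_pCons_le],
        auto simp: degree_pderiv)
qed

section \<open>Determinants\<close>

lemma det_mat_eq_sum_permutes:
  "Determinant.det (Matrix.mat n n (\<lambda>(i, j). f i j)) =
     (\<Sum>p | p permutes {0..<n}. of_int (sign p) * (\<Prod>i = 0..<n. f i (p i)))"
proof -
  have "Determinant.det (Matrix.mat n n (\<lambda>(i, j). f i j)) =
      (\<Sum>p | p permutes {0..<n}. of_int (sign p) * (\<Prod>i = 0..<n. Matrix.mat n n (\<lambda>(i, j). f i j) $$ (i, p i)))"
    by (rule det_def') simp
  also have "\<dots> = (\<Sum>p | p permutes {0..<n}. of_int (sign p) * (\<Prod>i = 0..<n. f i (p i)))"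
    by (intro sum.cong arg_cong2[where f = "(*)"] prod.cong refl)
       (auto dest: permutes_in_image)
  finally show ?thesis .
qed

lemma det_mat_mult_rows_cols:
  "Determinant.det (Matrix.mat n n (\<lambda>(i, j). a i * b j * f i j)) =
     (\<Prod>i<n. a i) * (\<Prod>j<n. b j) * Determinant.det (Matrix.mat n n (\<lambda>(i, j). f i j :: 'a :: comm_ring_1))"
proof -
  have "of_int (sign p) * (\<Prod>i = 0..<n. a i * b (p i) * f i (p i)) =
        (\<Prod>i<n. a i) * (\<Prod>j<n. b j) * (of_int (sign p) * (\<Prod>i = 0..<n. f i (p i)))"
    if "p permutes {0..<n}" for p
  proof -
    have "(\<Prod>i = 0..<n. b (p i)) = (\<Prod>i = 0..<n. b i)"
      using prod.permute[OF that, of b] by (simp add: comp_def)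
    then show ?thesis
      by (simp add: prod.distrib atLeast0LessThan mult_ac)
  qed
  then show ?thesis
    by (simp add: det_mat_eq_sum_permutes sum_distrib_left)
qed

lemma sum_binomial_products:
  assumes "i < n" "j < n"
  shows "(\<Sum>k<n. (i choose k) * (j choose k)) = (i + j) choose i"
proof -
  have "(\<Sum>k<n. (i choose k) * (j choose k)) = (\<Sum>k\<le>i. (i choose k) * (j choose k))"
    using assms by (intro sum.mono_neutral_right) auto
  also have "\<dots> = (\<Sum>k\<le>i. (j choose k) * (i choose (i - k)))"
    by (intro sum.cong refl) (simp add: binomial_symmetric[symmetric] mult.commute)
  also have "\<dots> = (j + i) choose i"
    by (rule vandermonde)
  finally show ?thesis
    by (simp add: add.commute)
qed

text \<open>The binomial matrix factors as \<open>L L\<^sup>T\<close> with \<open>L\<close> the unitriangular Pascal matrix.\<close>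
lemma det_mat_binomial: "Determinant.det (Matrix.mat n n (\<lambda>(i, j). of_nat ((i + j) choose i) :: 'a :: comm_ring_1)) = 1"
proof -
  define L :: "'a mat" where "L = Matrix.mat n n (\<lambda>(i, k). of_nat (i choose k))"
  have L: "L \<in> carrier_mat n n"
    by (simp add: L_def)
  have "Matrix.mat n n (\<lambda>(i, j). of_nat ((i + j) choose i)) = L * transpose_mat L"
    by (rule eq_matI)
       (auto simp: L_def scalar_prod_def atLeast0LessThan sum_binomial_products simp flip: of_nat_mult of_nat_sum)
  moreover have "Determinant.det L = 1"
  proof -
    have "Determinant.det L = prod_list (diag_mat L)"
      by (rule det_lower_triangular[OF _ L]) (simp add: L_def binomial_eq_0)
    also have "\<dots> = prod_list (map (\<lambda>i. 1) [0..<n])"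
      unfolding diag_mat_def by (intro arg_cong[where f = prod_list] map_cong) (auto simp: L_def)
    also have "\<dots> = 1"
      by (induction n) auto
    finally show ?thesis .
  qed
  ultimately show ?thesis
    using det_mult[OF L transpose_carrier_mat[THEN iffD2, OF L]] det_transpose[OF L] by simp
qed

lemma det_mat_signed_fact_nonzero:
  "Determinant.det (Matrix.mat n n (\<lambda>(i, j). (-1) ^ (i + j) * fact (i + j) :: complex)) \<noteq> 0"
proof -
  have "(-1) ^ (i + j) * fact (i + j) = ((-1) ^ i * fact i) * ((-1) ^ j * fact j) * (of_nat ((i + j) choose i) :: complex)"
    for i j :: nat
  proof -
    have "fact (i + j) = (fact i * fact j * ((i + j) choose i) :: nat)"
      using binomial_fact_lemma[of i "i + j"] by simp
    then have "(fact (i + j) :: complex) = fact i * fact j * of_nat ((i + j) choose i)"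
      by (metis of_nat_fact of_nat_mult)
    then show ?thesis
      by (simp add: power_add mult_ac)
  qed
  then show ?thesis
    by (simp add: det_mat_mult_rows_cols det_mat_binomial)
qed

section \<open>Polynomial functions of \<open>(\<Delta>, t)\<close>\<close>

definition bipoly_fun :: "(complex \<Rightarrow> complex \<Rightarrow> complex) \<Rightarrow> bool" where
  "bipoly_fun F \<longleftrightarrow> (\<exists>P :: complex poly poly. \<forall>\<Delta> t. poly (poly P [:\<Delta>:]) t = F \<Delta> t)"

lemma bipoly_fun_const: "bipoly_fun (\<lambda>\<Delta> t. c)"
  unfolding bipoly_fun_def by (rule exI[of _ "[:[:c:]:]"]) simp

lemma bipoly_fun_Delta: "bipoly_fun (\<lambda>\<Delta> t. \<Delta>)"
  unfolding bipoly_fun_def by (rule exI[of _ "[:0, 1:]"]) simp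

lemma bipoly_fun_t: "bipoly_fun (\<lambda>\<Delta> t. t)"
  unfolding bipoly_fun_def by (rule exI[of _ "[:[:0, 1:]:]"]) simp

lemma bipoly_fun_add: "bipoly_fun F \<Longrightarrow> bipoly_fun G \<Longrightarrow> bipoly_fun (\<lambda>\<Delta> t. F \<Delta> t + G \<Delta> t)"
  unfolding bipoly_fun_def by (metis poly_add)

lemma bipoly_fun_mult: "bipoly_fun F \<Longrightarrow> bipoly_fun G \<Longrightarrow> bipoly_fun (\<lambda>\<Delta> t. F \<Delta> t * G \<Delta> t)"
  unfolding bipoly_fun_def by (metis poly_mult)

lemma bipoly_fun_diff: "bipoly_fun F \<Longrightarrow> bipoly_fun G \<Longrightarrow> bipoly_fun (\<lambda>\<Delta> t. F \<Delta> t - G \<Delta> t)"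
  unfolding bipoly_fun_def by (metis poly_diff)

lemma bipoly_fun_sum:
  "finite A \<Longrightarrow> (\<And>a. a \<in> A \<Longrightarrow> bipoly_fun (F a)) \<Longrightarrow> bipoly_fun (\<lambda>\<Delta> t. \<Sum>a\<in>A. F a \<Delta> t)"
  by (induction A rule: finite_induct) (auto intro: bipoly_fun_const bipoly_fun_add)

lemma bipoly_fun_prod:
  "finite A \<Longrightarrow> (\<And>a. a \<in> A \<Longrightarrow> bipoly_fun (F a)) \<Longrightarrow> bipoly_fun (\<lambda>\<Delta> t. \<Prod>a\<in>A. F a \<Delta> t)"
  by (induction A rule: finite_induct) (auto intro: bipoly_fun_const bipoly_fun_mult)

lemma bipoly_fun_power: "bipoly_fun F \<Longrightarrow> bipoly_fun (\<lambda>\<Delta> t. F \<Delta> t ^ n)"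
  using bipoly_fun_prod[of "{..<n}" "\<lambda>_. F"] by simp

lemma bipoly_fun_det:
  assumes "\<And>i j. i < n \<Longrightarrow> j < n \<Longrightarrow> bipoly_fun (f i j)"
  shows "bipoly_fun (\<lambda>\<Delta> t. Determinant.det (Matrix.mat n n (\<lambda>(i, j). f i j \<Delta> t)))"
  unfolding det_mat_eq_sum_permutes
  by (intro bipoly_fun_sum bipoly_fun_mult bipoly_fun_const bipoly_fun_prod assms)
     (auto simp: finite_permutations dest: permutes_in_image)

definition bipoly_coeffs :: "(complex \<Rightarrow> complex poly) \<Rightarrow> bool" where
  "bipoly_coeffs Q \<longleftrightarrow> (\<forall>k. bipoly_fun (\<lambda>\<Delta> t. coeff (Q \<Delta>) k))"

lemma bipoly_coeffs_const: "bipoly_coeffs (\<lambda>\<Delta>. [:c:])"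
  unfolding bipoly_coeffs_def by (auto simp: coeff_pCons split: nat.split intro: bipoly_fun_const)

lemma bipoly_coeffs_pCons:
  assumes "bipoly_fun (\<lambda>\<Delta> t. a \<Delta>)" and "bipoly_coeffs Q"
  shows "bipoly_coeffs (\<lambda>\<Delta>. pCons (a \<Delta>) (Q \<Delta>))"
  unfolding bipoly_coeffs_def
proof
  show "bipoly_fun (\<lambda>\<Delta> t. coeff (pCons (a \<Delta>) (Q \<Delta>)) k)" for k
    using assms by (cases k) (simp_all add: bipoly_coeffs_def)
qed

lemma bipoly_coeffs_diff:
  "bipoly_coeffs P \<Longrightarrow> bipoly_coeffs Q \<Longrightarrow> bipoly_coeffs (\<lambda>\<Delta>. P \<Delta> - Q \<Delta>)"
  unfolding bipoly_coeffs_def by (auto intro: bipoly_fun_diff)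

lemma bipoly_coeffs_smult: "bipoly_coeffs Q \<Longrightarrow> bipoly_coeffs (\<lambda>\<Delta>. Polynomial.smult c (Q \<Delta>))"
  unfolding bipoly_coeffs_def by (auto intro: bipoly_fun_mult bipoly_fun_const)

lemma bipoly_coeffs_pderiv: "bipoly_coeffs Q \<Longrightarrow> bipoly_coeffs (\<lambda>\<Delta>. pderiv (Q \<Delta>))"
  unfolding bipoly_coeffs_def coeff_pderiv by (auto intro: bipoly_fun_mult bipoly_fun_const)

lemma bipoly_coeffs_mult:
  "bipoly_coeffs P \<Longrightarrow> bipoly_coeffs Q \<Longrightarrow> bipoly_coeffs (\<lambda>\<Delta>. P \<Delta> * Q \<Delta>)"
  unfolding bipoly_coeffs_def coeff_mult by (auto intro!: bipoly_fun_sum bipoly_fun_mult)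

lemma bipoly_fun_poly:
  assumes "bipoly_coeffs Q" and "\<And>\<Delta>. degree (Q \<Delta>) \<le> d"
  shows "bipoly_fun (\<lambda>\<Delta> t. poly (Q \<Delta>) t)"
proof -
  have "poly (Q \<Delta>) t = (\<Sum>i\<le>d. coeff (Q \<Delta>) i * t ^ i)" for \<Delta> t
    unfolding poly_altdef by (rule sum.mono_neutral_left) (use assms(2) in \<open>auto simp: coeff_eq_0\<close>)
  moreover have "bipoly_fun (\<lambda>\<Delta> t. \<Sum>i\<le>d. coeff (Q \<Delta>) i * t ^ i)"
    using assms(1) unfolding bipoly_coeffs_def
    by (intro bipoly_fun_sum bipoly_fun_mult bipoly_fun_power bipoly_fun_t) auto
  ultimately show ?thesis
    by simp
qed

lemma bipoly_fun_phi_numerator: "bipoly_fun (\<lambda>\<Delta> t. poly (phi_numerator \<Delta> j) t)"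
proof (rule bipoly_fun_poly[OF _ degree_phi_numerator])
  have quadratic: "bipoly_coeffs (\<lambda>\<Delta>. [:1, -2 * \<Delta>, 1:])"
    by (intro bipoly_coeffs_pCons bipoly_coeffs_const bipoly_fun_const bipoly_fun_mult bipoly_fun_Delta)
  show "bipoly_coeffs (\<lambda>\<Delta>. phi_numerator \<Delta> j)"
  proof (induction j)
    case 0
    then show ?case
      using bipoly_coeffs_const[of 1] by (simp add: one_pCons)
  next
    case (Suc j)
    then show ?case
      unfolding phi_numerator.simps
      by (intro bipoly_coeffs_diff bipoly_coeffs_pCons bipoly_coeffs_pderiv bipoly_coeffs_mult
          bipoly_coeffs_smult quadratic bipoly_fun_const)
  qed
qed

section \<open>The extension of \<open>htilde\<^sub>n\<close> across \<open>z = 1\<close>\<close>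

lemma holomorphic_factor_vanishing_derivs:
  fixes f :: "complex \<Rightarrow> complex"
  assumes holf: "f holomorphic_on ball \<xi> r"
      and dfz: "\<And>i. i < n \<Longrightarrow> (deriv ^^ i) f \<xi> = 0"
  obtains g where "g holomorphic_on ball \<xi> r" "\<And>w. w \<in> ball \<xi> r \<Longrightarrow> f w = (w - \<xi>) ^ n * g w"
    "g \<xi> = (deriv ^^ n) f \<xi> / fact n"
proof -
  define g where "g w = suminf (\<lambda>i. (deriv ^^ (i + n)) f \<xi> / (fact(i + n)) * (w - \<xi>)^i)" for w
  have sumsg: "(\<lambda>i. (deriv ^^ (i + n)) f \<xi> / (fact(i + n)) * (w - \<xi>)^i) sums g w"
   and feq: "f w = (w - \<xi>)^n * g w"
       if w: "w \<in> ball \<xi> r" for w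
  proof -
    define powf where "powf = (\<lambda>i. (deriv ^^ i) f \<xi>/(fact i) * (w - \<xi>)^i)"
    have "powf sums f w"
      unfolding powf_def by (rule holomorphic_power_series [OF holf w])
    moreover have "(\<Sum>i<n. powf i) = 0"
      by (intro sum.neutral) (simp add: powf_def dfz)
    ultimately have fsums: "(\<lambda>i. powf (i+n)) sums (f w)"
      using sums_iff_shift'[of powf n "f w"] by simp
    then have *: "summable (\<lambda>i. (w - \<xi>) ^ n * ((deriv ^^ (i + n)) f \<xi> * (w - \<xi>) ^ i / fact (i + n)))"
      unfolding powf_def using sums_summable by (auto simp: power_add mult_ac)
    have "summable (\<lambda>i. (deriv ^^ (i + n)) f \<xi> * (w - \<xi>) ^ i / fact (i + n))"
    proof (cases "w = \<xi>")
      case False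
      then show ?thesis
        using summable_mult [OF *, of "1 / (w - \<xi>) ^ n"] by simp
    next
      case True
      then show ?thesis
        by (auto simp: power_0_left intro!: summable_finite [of "{0}"] split: if_split_asm)
    qed
    then show sumsg: "(\<lambda>i. (deriv ^^ (i + n)) f \<xi> / (fact(i + n)) * (w - \<xi>)^i) sums g w"
      by (simp add: summable_sums_iff g_def)
    show "f w = (w - \<xi>)^n * g w"
      using sums_mult [OF sumsg, of "(w - \<xi>) ^ n"]
      by (intro sums_unique2 [OF fsums]) (auto simp: power_add mult_ac powf_def)
  qed
  have "g holomorphic_on ball \<xi> r"
    by (meson sumsg power_series_holomorphic)
  moreover have "g \<xi> = (deriv ^^ n) f \<xi> / fact n"
    unfolding g_def by (subst suminf_finite [of "{0}"]) auto
  ultimately show ?thesis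
    using feq that by blast
qed

text \<open>The derivatives of \<open>W\<close> at \<open>\<xi>\<close> are read off from \<open>(v - \<xi>)\<^sup>p K(v)\<close> as residues.\<close>
lemma holomorphic_factor_antiderivative:
  fixes W K :: "complex \<Rightarrow> complex"
  assumes r: "r > 0"
      and holW: "W holomorphic_on ball \<xi> r" and W0: "W \<xi> = 0"
      and holK: "K holomorphic_on ball \<xi> r"
      and dW: "\<And>v. v \<in> ball \<xi> r \<Longrightarrow> (W has_field_derivative (v - \<xi>) ^ p * K v) (at v)"
  obtains K' where "K' holomorphic_on ball \<xi> r" "\<And>v. v \<in> ball \<xi> r \<Longrightarrow> W v = (v - \<xi>) ^ Suc p * K' v"
    "K' \<xi> = K \<xi> / of_nat (Suc p)"
proof -
  define G where "G v = (v - \<xi>) ^ p * K v" for v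
  have holG: "G holomorphic_on ball \<xi> r"
    unfolding G_def using holK by (intro holomorphic_intros)
  have \<xi>: "\<xi> \<in> ball \<xi> r"
    using r by simp
  have "deriv W v = G v" if "v \<in> ball \<xi> r" for v
    using DERIV_imp_deriv[OF dW[OF that]] by (simp add: G_def)
  then have deriv_Suc: "(deriv ^^ Suc j) W \<xi> = (deriv ^^ j) G \<xi>" for j
    unfolding funpow_Suc_right o_apply
    by (intro higher_deriv_transform_within_open[OF holomorphic_deriv[OF holW open_ball] holG open_ball \<xi>])
       auto
  have res: "(deriv ^^ j) G \<xi> = fact j * residue (\<lambda>v. G v / (v - \<xi>) ^ Suc j) \<xi>" for j
    using residue_holomorphic_over_power[OF open_ball \<xi> holG, of j] by (simp add: field_simps)
  have "(deriv ^^ j) G \<xi> = 0" if "j < p" for j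
  proof -
    have "(v - \<xi>) ^ p = (v - \<xi>) ^ (p - Suc j) * (v - \<xi>) ^ Suc j" for v
      using that by (metis Suc_leI le_add_diff_inverse2 power_add)
    then have "residue (\<lambda>v. G v / (v - \<xi>) ^ Suc j) \<xi> = residue (\<lambda>v. (v - \<xi>) ^ (p - Suc j) * K v) \<xi>"
      by (intro residue_cong refl) (auto simp: G_def eventually_at_filter intro!: always_eventually)
    also have "\<dots> = 0"
      by (rule residue_holo[OF open_ball \<xi>]) (use holK in \<open>intro holomorphic_intros\<close>)
    finally show ?thesis
      using res[of j] by simp
  qed
  then have "(deriv ^^ i) W \<xi> = 0" if "i < Suc p" for i
    using that W0 deriv_Suc by (cases i) auto
  then obtain K' where K': "K' holomorphic_on ball \<xi> r" "\<And>v. v \<in> ball \<xi> r \<Longrightarrow> W v = (v - \<xi>) ^ Suc p * K' v"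
      "K' \<xi> = (deriv ^^ Suc p) W \<xi> / fact (Suc p)"
    using holomorphic_factor_vanishing_derivs[OF holW] by blast
  have "residue (\<lambda>v. G v / (v - \<xi>) ^ Suc p) \<xi> = residue (\<lambda>v. K v / (v - \<xi>)) \<xi>"
    by (intro residue_cong refl) (auto simp: G_def eventually_at_filter intro!: always_eventually)
  also have "\<dots> = K \<xi>"
    by (rule residue_simple[OF open_ball \<xi> holK])
  finally have "K' \<xi> = K \<xi> / of_nat (Suc p)"
    unfolding K'(3) deriv_Suc res by (simp add: field_simps del: of_nat_Suc)
  with K' show ?thesis
    using that by blast
qed

lemma holomorphic_factor_divide:
  fixes L D K :: "complex \<Rightarrow> complex"
  assumes r: "0 < r" and holL: "L holomorphic_on ball \<xi> r" and L: "L \<xi> \<noteq> 0"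
    and holK: "K holomorphic_on ball \<xi> r"
    and LD: "\<And>v. v \<in> ball \<xi> r \<Longrightarrow> L v * D v = (v - \<xi>) ^ q * K v"
  obtains r' where "0 < r'" "r' \<le> r" "(\<lambda>v. K v / L v) holomorphic_on ball \<xi> r'"
    "\<And>v. v \<in> ball \<xi> r' \<Longrightarrow> D v = (v - \<xi>) ^ q * (K v / L v)"
proof -
  have "continuous (at \<xi>) L"
    using holL r by (meson centre_in_ball continuous_on_eq_continuous_at holomorphic_on_imp_continuous_on open_ball)
  then obtain e where e: "e > 0" "\<And>y. dist \<xi> y < e \<Longrightarrow> L y \<noteq> 0"
    using continuous_at_avoid[of \<xi> L 0] L by auto
  define r' where "r' = min r e"
  have sub: "ball \<xi> r' \<subseteq> ball \<xi> r"
    by (auto simp: r'_def)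
  have L0: "L v \<noteq> 0" if "v \<in> ball \<xi> r'" for v
    using that e by (auto simp: r'_def)
  show ?thesis
  proof
    show "0 < r'" "r' \<le> r"
      using r e by (auto simp: r'_def)
    show "(\<lambda>v. K v / L v) holomorphic_on ball \<xi> r'"
      using L0 by (intro holomorphic_intros holomorphic_on_subset[OF holK sub] holomorphic_on_subset[OF holL sub])
    show "D v = (v - \<xi>) ^ q * (K v / L v)" if "v \<in> ball \<xi> r'" for v
      using LD[of v] L0[OF that] sub that by (auto simp: eq_divide_eq mult.commute)
  qed
qed

definition hankel_mat :: "complex \<Rightarrow> complex \<Rightarrow> nat \<Rightarrow> complex mat" where
  "hankel_mat t \<Delta> n = Matrix.mat n n (\<lambda>(i, j). phi \<Delta> (i + j) t)"

definition bordered_det :: "complex \<Rightarrow> complex \<Rightarrow> nat \<Rightarrow> nat \<Rightarrow> complex \<Rightarrow> complex" where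
  "bordered_det t \<Delta> n m v = Determinant.det (Matrix.mat n n
     (\<lambda>(i, j). if j < n - 1 then phi \<Delta> (i + j) t else phi \<Delta> (i + m) (t * v)))"

lemma in_ball_1_1_nonzero: "v \<in> ball (1::complex) 1 \<Longrightarrow> v \<noteq> 0"
  by auto

lemma bordered_det_expansion:
  assumes "1 \<le> n"
  shows "bordered_det t \<Delta> n m v = (\<Sum>i<n. phi \<Delta> (i + m) (t * v) * cofactor (hankel_mat t \<Delta> n) i (n - 1))"
proof -
  define A where "A = Matrix.mat n n (\<lambda>(i, j). if j < n - 1 then phi \<Delta> (i + j) t else phi \<Delta> (i + m) (t * v))"
  have A: "A \<in> carrier_mat n n"
    by (simp add: A_def)
  have "bordered_det t \<Delta> n m v = (\<Sum>i<n. A $$ (i, n - 1) * cofactor A i (n - 1))"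
    unfolding bordered_det_def A_def[symmetric] using assms by (intro laplace_expansion_column[OF A]) auto
  also have "\<dots> = (\<Sum>i<n. phi \<Delta> (i + m) (t * v) * cofactor (hankel_mat t \<Delta> n) i (n - 1))"
  proof (rule sum.cong[OF refl])
    fix i
    assume i: "i \<in> {..<n}"
    have "mat_delete A i (n - 1) = mat_delete (hankel_mat t \<Delta> n) i (n - 1)"
      by (rule eq_matI) (auto simp: mat_delete_def A_def hankel_mat_def)
    then show "A $$ (i, n - 1) * cofactor A i (n - 1) = phi \<Delta> (i + m) (t * v) * cofactor (hankel_mat t \<Delta> n) i (n - 1)"
      using i assms unfolding cofactor_def by (simp add: A_def)
  qed
  finally show ?thesis .
qed

lemma bordered_det_holomorphic:
  assumes "t \<noteq> 0" "1 \<le> n"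
  shows "bordered_det t \<Delta> n m holomorphic_on ball 1 1"
proof -
  have "(phi \<Delta> k \<circ> (\<lambda>v. t * v)) holomorphic_on ball 1 1" for k
    by (rule holomorphic_on_compose_gen[OF _ phi_holomorphic])
       (use assms(1) in_ball_1_1_nonzero in \<open>auto intro: holomorphic_intros\<close>)
  then show ?thesis
    unfolding bordered_det_expansion[OF assms(2), abs_def] comp_def by (intro holomorphic_intros)
qed

lemma bordered_det_at_1_eq_0:
  assumes "1 \<le> n" "m < n - 1"
  shows "bordered_det t \<Delta> n m 1 = 0"
proof -
  define A where "A = Matrix.mat n n (\<lambda>(i, j). if j < n - 1 then phi \<Delta> (i + j) t else phi \<Delta> (i + m) (t * 1))"
  have A: "A \<in> carrier_mat n n"
    by (simp add: A_def)
  have "Determinant.det A = 0"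
    by (rule det_identical_columns[OF A, of m "n - 1"]) (use assms in \<open>auto intro!: eq_vecI simp: A_def\<close>)
  then show ?thesis
    by (simp add: bordered_det_def A_def)
qed

lemma bordered_det_at_1_last:
  assumes "1 \<le> n"
  shows "bordered_det t \<Delta> n (n - 1) 1 = Determinant.det (hankel_mat t \<Delta> n)"
  unfolding bordered_det_def hankel_mat_def
  by (rule arg_cong[where f = Determinant.det], rule eq_matI)
     (auto intro!: arg_cong[where f = "\<lambda>k. phi \<Delta> k t"])

lemma bordered_det_has_field_derivative:
  assumes t: "t \<noteq> 0" and n: "1 \<le> n" and v: "v \<in> ball 1 1"
  shows "((\<lambda>v. (t * v - 2 * \<Delta> + inverse (t * v)) * bordered_det t \<Delta> n m v)
           has_field_derivative bordered_det t \<Delta> n (Suc m) v / v) (at v)"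
proof -
  have v0: "v \<noteq> 0"
    using in_ball_1_1_nonzero[OF v] .
  let ?C = "\<lambda>i. cofactor (hankel_mat t \<Delta> n) i (n - 1)"
  have "((\<lambda>v. (t * v - 2 * \<Delta> + inverse (t * v)) * phi \<Delta> k (t * v))
          has_field_derivative phi \<Delta> (Suc k) (t * v) / v) (at v)" for k
  proof -
    have "((\<lambda>v. (\<lambda>u. (u - 2 * \<Delta> + inverse u) * phi \<Delta> k u) (t * v))
           has_field_derivative phi \<Delta> (Suc k) (t * v) / (t * v) * t) (at v)"
      by (rule DERIV_chain2[OF phi_Suc_has_field_derivative]) (use t v0 in \<open>auto intro!: derivative_eq_intros\<close>)
    then show ?thesis
      using t by simp
  qed
  then have "((\<lambda>v. \<Sum>i<n. ?C i * ((t * v - 2 * \<Delta> + inverse (t * v)) * phi \<Delta> (i + m) (t * v)))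
        has_field_derivative (\<Sum>i<n. ?C i * (phi \<Delta> (Suc (i + m)) (t * v) / v))) (at v)"
    by (intro DERIV_sum DERIV_cmult)
  then show ?thesis
    by (simp add: bordered_det_expansion[OF n] sum_distrib_left sum_divide_distrib mult_ac)
qed

lemma bordered_det_vanishing_step:
  assumes t: "t \<noteq> 0" and c: "t - 2 * \<Delta> + inverse t \<noteq> 0" and n: "1 \<le> n" and m: "m < n - 1"
    and r: "0 < r" "r \<le> 1" and holK: "K holomorphic_on ball 1 r"
    and K: "\<And>v. v \<in> ball 1 r \<Longrightarrow> bordered_det t \<Delta> n (Suc m) v = (v - 1) ^ p * K v"
  shows "\<exists>r' K'. 0 < r' \<and> r' \<le> 1 \<and> K' holomorphic_on ball 1 r' \<and>
    (\<forall>v\<in>ball 1 r'. bordered_det t \<Delta> n m v = (v - 1) ^ Suc p * K' v) \<and>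
    K' 1 = K 1 / ((t - 2 * \<Delta> + inverse t) * of_nat (Suc p))"
proof -
  define L where "L v = t * v - 2 * \<Delta> + inverse (t * v)" for v
  define W where "W v = L v * bordered_det t \<Delta> n m v" for v
  have sub: "ball 1 r \<subseteq> ball (1::complex) 1"
    using r by auto
  have holL: "L holomorphic_on ball 1 1"
    unfolding L_def using t in_ball_1_1_nonzero by (intro holomorphic_intros) auto
  have holW: "W holomorphic_on ball 1 r"
    unfolding W_def using bordered_det_holomorphic[OF t n] holL
    by (intro holomorphic_intros) (auto intro: holomorphic_on_subset[OF _ sub])
  have W1: "W 1 = 0"
    unfolding W_def using bordered_det_at_1_eq_0[OF n m] by simp
  have "v \<noteq> 0" if "v \<in> ball 1 r" for v :: complex
    using in_ball_1_1_nonzero sub that by blast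
  then have holKv: "(\<lambda>v. K v / v) holomorphic_on ball 1 r"
    using holK by (intro holomorphic_intros) auto
  have dW: "(W has_field_derivative (v - 1) ^ p * (K v / v)) (at v)" if v: "v \<in> ball 1 r" for v
  proof -
    have "v \<in> ball 1 1"
      using sub v by blast
    then have "(W has_field_derivative bordered_det t \<Delta> n (Suc m) v / v) (at v)"
      unfolding W_def L_def by (rule bordered_det_has_field_derivative[OF t n])
    then show ?thesis
      using K[OF v] by simp
  qed
  obtain K2 where holK2: "K2 holomorphic_on ball 1 r"
    and W: "\<And>v. v \<in> ball 1 r \<Longrightarrow> W v = (v - 1) ^ Suc p * K2 v" and K2: "K2 1 = K 1 / 1 / of_nat (Suc p)"
    using holomorphic_factor_antiderivative[OF r(1) holW W1 holKv dW] by blast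
  have L1: "L 1 = t - 2 * \<Delta> + inverse t"
    by (simp add: L_def)
  have LD: "L v * bordered_det t \<Delta> n m v = (v - 1) ^ Suc p * K2 v" if "v \<in> ball 1 r" for v
    using W[OF that] unfolding W_def .
  obtain r' where "0 < r'" "r' \<le> r" "(\<lambda>v. K2 v / L v) holomorphic_on ball 1 r'"
    "\<And>v. v \<in> ball 1 r' \<Longrightarrow> bordered_det t \<Delta> n m v = (v - 1) ^ Suc p * (K2 v / L v)"
    using holomorphic_factor_divide[OF r(1) holomorphic_on_subset[OF holL sub] _ holK2 LD] c L1 by auto
  then show ?thesis
    using r K2 L1 by (intro exI[of _ r'] exI[of _ "\<lambda>v. K2 v / L v"]) auto
qed

lemma bordered_det_vanishing_order:
  assumes t: "t \<noteq> 0" and c: "t - 2 * \<Delta> + inverse t \<noteq> 0" and n: "1 \<le> n"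
  shows "p \<le> n - 1 \<Longrightarrow> \<exists>r K. 0 < r \<and> r \<le> 1 \<and> K holomorphic_on ball 1 r \<and>
    (\<forall>v\<in>ball 1 r. bordered_det t \<Delta> n (n - 1 - p) v = (v - 1) ^ p * K v) \<and>
    K 1 = Determinant.det (hankel_mat t \<Delta> n) / ((t - 2 * \<Delta> + inverse t) ^ p * fact p)"
proof (induction p)
  case 0
  show ?case
    using bordered_det_holomorphic[OF t n] bordered_det_at_1_last[OF n]
    by (intro exI[of _ 1] exI[of _ "bordered_det t \<Delta> n (n - 1)"]) auto
next
  case (Suc p)
  then obtain r K where r: "0 < r" "r \<le> 1" and holK: "K holomorphic_on ball 1 r"
    and K: "\<forall>v\<in>ball 1 r. bordered_det t \<Delta> n (n - 1 - p) v = (v - 1) ^ p * K v"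
    and K1: "K 1 = Determinant.det (hankel_mat t \<Delta> n) / ((t - 2 * \<Delta> + inverse t) ^ p * fact p)"
    by auto
  have m: "n - 1 - Suc p < n - 1" "Suc (n - 1 - Suc p) = n - 1 - p"
    using Suc.prems by auto
  have K': "bordered_det t \<Delta> n (Suc (n - 1 - Suc p)) v = (v - 1) ^ p * K v" if "v \<in> ball 1 r" for v
    using K that m(2) by simp
  obtain r' K' where r': "0 < r'" "r' \<le> 1" "K' holomorphic_on ball 1 r'"
    "\<forall>v\<in>ball 1 r'. bordered_det t \<Delta> n (n - 1 - Suc p) v = (v - 1) ^ Suc p * K' v"
    and K'1: "K' 1 = K 1 / ((t - 2 * \<Delta> + inverse t) * of_nat (Suc p))"
    using bordered_det_vanishing_step[OF t c n m(1) r holK K'] by auto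
  have "K' 1 = Determinant.det (hankel_mat t \<Delta> n) / ((t - 2 * \<Delta> + inverse t) ^ Suc p * fact (Suc p))"
    by (simp add: K'1 K1 divide_divide_eq_left mult_ac)
  with r' show ?case
    by (intro exI[of _ r'] exI[of _ K']) simp
qed

lemma hN_eq_bordered_det:
  "hN t \<Delta> n z = fact (n - 1) * ((t - 2 * \<Delta> + inverse t) * (z / (z - 1))) ^ (n - 1) *
     bordered_det t \<Delta> n 0 z / Determinant.det (hankel_mat t \<Delta> n)"
  unfolding hN_def bordered_det_def hankel_mat_def by (simp only: add_0_right)

lemma inverse_in_ball_1:
  fixes z :: complex
  assumes "z \<in> ball 1 (min (1/2) (r/2))"
  shows "inverse z \<in> ball 1 r"
proof -
  have d: "norm (z - 1) < 1/2" "norm (z - 1) < r/2"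
    using assms by (auto simp: dist_norm norm_minus_commute)
  then have z: "norm z > 1/2"
    using norm_triangle_ineq2[of 1 "1 - z"] by (simp add: norm_minus_commute)
  have r: "r > 0"
    using d(2) norm_ge_zero[of "z - 1"] by linarith
  then have "r * (1/2) < r * norm z"
    using z by (intro mult_strict_left_mono)
  then have "norm (z - 1) < r * norm z"
    using d(2) by simp
  moreover have "dist 1 (inverse z) = norm (z - 1) / norm z"
  proof -
    have "z \<noteq> 0"
      using z by auto
    then show ?thesis
      by (simp add: dist_norm field_simps norm_divide flip: norm_divide)
  qed
  ultimately show ?thesis
    using z r by (simp add: divide_less_eq)
qed

lemma htilde_holomorphic_extension:
  assumes t: "t \<noteq> 0" and c: "t - 2 * \<Delta> + inverse t \<noteq> 0" and n: "1 \<le> n"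
      and B: "Determinant.det (hankel_mat t \<Delta> n) \<noteq> 0"
  shows "\<exists>\<rho>>0. \<exists>H. H holomorphic_on ball 1 \<rho> \<and> H 1 = 1 \<and>
           (\<forall>z\<in>ball 1 \<rho>. z \<noteq> 1 \<longrightarrow> htilde t \<Delta> n z = H z)"
proof -
  define c where "c = t - 2 * \<Delta> + inverse t"
  obtain r K where r: "r > 0" "r \<le> 1" and holK: "K holomorphic_on ball 1 r"
    and K: "\<forall>v\<in>ball 1 r. bordered_det t \<Delta> n 0 v = (v - 1) ^ (n - 1) * K v"
    and K1: "K 1 = Determinant.det (hankel_mat t \<Delta> n) / (c ^ (n - 1) * fact (n - 1))"
    using bordered_det_vanishing_order[OF t c n, of "n - 1"] unfolding c_def by auto
  define \<rho> where "\<rho> = min (1/2) (r/2)"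
  define H where "H z = fact (n - 1) * c ^ (n - 1) * K (inverse z) / Determinant.det (hankel_mat t \<Delta> n)" for z
  show ?thesis
  proof (intro exI conjI)
    show "\<rho> > 0"
      using r by (simp add: \<rho>_def)
    have "(K \<circ> inverse) holomorphic_on ball 1 \<rho>"
      by (rule holomorphic_on_compose_gen[OF _ holK])
         (use inverse_in_ball_1 in \<open>auto simp: \<rho>_def intro!: holomorphic_intros\<close>)
    then show "H holomorphic_on ball 1 \<rho>"
      unfolding H_def by (intro holomorphic_intros) (simp_all add: comp_def)
    show "H 1 = 1"
      using B c by (simp add: H_def K1 c_def)
    show "\<forall>z\<in>ball 1 \<rho>. z \<noteq> 1 \<longrightarrow> htilde t \<Delta> n z = H z"
    proof (intro ballI impI)
      fix z :: complex
      assume z: "z \<in> ball 1 \<rho>" and z1: "z \<noteq> 1"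
      define v where "v = inverse z"
      have v: "v \<in> ball 1 r"
        using inverse_in_ball_1 z by (simp add: \<rho>_def v_def)
      have z0: "z \<noteq> 0"
        using z by (auto simp: \<rho>_def)
      have "z * (c * (v / (v - 1))) * (v - 1) = c"
        using z1 z0 by (simp add: v_def field_simps)
      then have "z ^ (n - 1) * (c * (v / (v - 1))) ^ (n - 1) * (v - 1) ^ (n - 1) = c ^ (n - 1)"
        by (simp flip: power_mult_distrib)
      then show "htilde t \<Delta> n z = H z"
        using K v unfolding htilde_def hN_eq_bordered_det H_def c_def[symmetric] v_def[symmetric]
        by (simp add: v_def mult_ac)
    qed
  qed
qed

section \<open>The iterated residue\<close>

lemma iter_res_cong:
  fixes \<rho> :: real
  assumes "\<rho> > 0"
    and "\<And>q. length q = n \<Longrightarrow> set q \<subseteq> ball 1 \<rho> - {1} \<Longrightarrow> distinct q \<Longrightarrow> F q = G q"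
  shows "iter_res n F [] = iter_res n G []"
  using assms(2)
proof (induction n arbitrary: F G)
  case 0
  then show ?case by simp
next
  case (Suc n)
  have "residue (\<lambda>w. F (q @ [w])) 1 = residue (\<lambda>w. G (q @ [w])) 1"
    if q: "length q = n" "set q \<subseteq> ball 1 \<rho> - {1}" "distinct q" for q
  proof (rule residue_cong[OF _ refl])
    have "\<forall>\<^sub>F w in at (1::complex). w \<in> ball 1 \<rho> \<and> w \<noteq> 1"
      using eventually_at_ball'[OF assms(1), of 1 UNIV] by simp
    moreover have "\<forall>\<^sub>F w in at (1::complex). \<forall>a\<in>set q. w \<noteq> a"
      by (rule eventually_ball_finite) (auto intro: eventually_neq_at_within)
    ultimately show "\<forall>\<^sub>F w in at 1. F (q @ [w]) = G (q @ [w])"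
      by eventually_elim (use Suc.prems q in auto)
  qed
  then show ?case
    using Suc.IH[of "\<lambda>zs. residue (\<lambda>w. F (zs @ [w])) 1" "\<lambda>zs. residue (\<lambda>w. G (zs @ [w])) 1"] by simp
qed

definition cross_factor :: "complex \<Rightarrow> complex \<Rightarrow> complex \<Rightarrow> complex \<Rightarrow> complex" where
  "cross_factor t \<Delta> a b = t ^ 2 - 2 * \<Delta> * t * b + a * b"

text \<open>The matrix of \<open>htilde_s\<close> with \<open>htilde (N - i)\<close> replaced by \<open>Hs (N - i)\<close> and column \<open>j\<close>
  divided by the factor \<open>(z\<^sub>j - 1)\<^sup>s\<^sup>-\<^sup>j\<close> of the denominator of \<open>J\<close>.\<close>
definition residue_mat :: "(nat \<Rightarrow> complex \<Rightarrow> complex) \<Rightarrow> nat \<Rightarrow> nat \<Rightarrow> complex list \<Rightarrow> complex mat" where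
  "residue_mat Hs N k zs = Matrix.mat k k
     (\<lambda>(i, j). (zs ! j - 1) ^ (k - 1 - i) * (zs ! j) ^ i * Hs (N - i) (zs ! j) / (zs ! j - 1) ^ (k - j))"

definition reduced_prefactor :: "complex \<Rightarrow> complex \<Rightarrow> nat \<Rightarrow> int \<Rightarrow> nat \<Rightarrow> complex list \<Rightarrow> complex" where
  "reduced_prefactor t \<Delta> N r k zs =
     (\<Prod>j<k. (t ^ 2 - 2 * \<Delta> * t + zs ! j) ^ (k - 1 - j) / (zs ! j) powi (int N - r))
   * (\<Prod>j<k. \<Prod>l\<in>{j<..<k}. 1 / cross_factor t \<Delta> (zs ! j) (zs ! l))"

text \<open>\<open>J\<close> after cancelling the Vandermonde denominator of \<open>htilde_s\<close> against the factors \<open>z\<^sub>j - z\<^sub>k\<close>.\<close>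
definition reduced_integrand ::
    "complex \<Rightarrow> complex \<Rightarrow> (nat \<Rightarrow> complex \<Rightarrow> complex) \<Rightarrow> nat \<Rightarrow> int \<Rightarrow> nat \<Rightarrow> complex list \<Rightarrow> complex" where
  "reduced_integrand t \<Delta> Hs N r k zs = reduced_prefactor t \<Delta> N r k zs * Determinant.det (residue_mat Hs N k zs)"

lemma Jfun_eq_reduced_integrand:
  fixes zs :: "complex list"
  assumes len: "length zs = s" and dist: "distinct zs"
      and H: "\<And>i j. i < s \<Longrightarrow> j < s \<Longrightarrow> Hs (N - i) (zs ! j) = htilde t \<Delta> (N - i) (zs ! j)"
  shows "Jfun t \<Delta> N r s zs = reduced_integrand t \<Delta> Hs N r s zs"
proof -
  define A where "A = t ^ 2 - 2 * \<Delta> * t"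
  define e where "e = int N - r"
  define V where "V = (\<Prod>i<s. \<Prod>j\<in>{i<..<s}. (zs ! i - zs ! j))"
  define M where "M = Matrix.mat s s (\<lambda>(i, j). (zs ! j - 1) ^ (s - 1 - i) * (zs ! j) ^ i * htilde t \<Delta> (N - i) (zs ! j))"
  define D where "D = (\<Prod>j<s. 1 / (zs ! j - 1) ^ (s - j))"
  define P1 where "P1 = (\<Prod>j<s. (A + zs ! j) ^ (s - 1 - j) / (zs ! j) powi e)"
  define P2 where "P2 = (\<Prod>j<s. \<Prod>l\<in>{j<..<s}. 1 / cross_factor t \<Delta> (zs ! j) (zs ! l))"
  have V: "V \<noteq> 0"
    unfolding V_def using dist len by (auto simp: nth_eq_iff_index_eq)
  have "residue_mat Hs N s zs = Matrix.mat s s (\<lambda>(i, j). 1 * (1 / (zs ! j - 1) ^ (s - j)) *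
      ((zs ! j - 1) ^ (s - 1 - i) * (zs ! j) ^ i * htilde t \<Delta> (N - i) (zs ! j)))"
    by (rule eq_matI) (auto simp: residue_mat_def H)
  then have "Determinant.det (residue_mat Hs N s zs) = (\<Prod>i<s. 1) * D * Determinant.det M"
    unfolding D_def M_def by (simp only: det_mat_mult_rows_cols)
  then have "Determinant.det (residue_mat Hs N s zs) = D * Determinant.det M"
    by simp
  moreover have "(\<Prod>j<s. (A + zs ! j) ^ (s - 1 - j) / ((zs ! j) powi e * (zs ! j - 1) ^ (s - j))) = P1 * D"
    unfolding P1_def D_def prod.distrib[symmetric] by (intro prod.cong refl) simp
  moreover have "(\<Prod>j<s. \<Prod>k\<in>{j<..<s}. (zs ! j - zs ! k) / (t ^ 2 - 2 * \<Delta> * t * zs ! k + zs ! j * zs ! k)) = V * P2"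
    unfolding V_def P2_def prod.distrib[symmetric] by (intro prod.cong refl) (simp add: cross_factor_def)
  ultimately have "Jfun t \<Delta> N r s zs = (P1 * D) * (V * P2) * (Determinant.det M / V)"
    "reduced_integrand t \<Delta> Hs N r s zs = P1 * P2 * (D * Determinant.det M)"
    unfolding Jfun_def htilde_s_def reduced_integrand_def reduced_prefactor_def
      A_def[symmetric] e_def[symmetric] M_def[symmetric] V_def[symmetric] P1_def[symmetric] P2_def[symmetric]
    by simp_all
  then show ?thesis
    using V by (simp add: field_simps)
qed

lemma prod_pairs_snoc:
  assumes q: "length q = k"
  shows "(\<Prod>j<Suc k. \<Prod>l\<in>{j<..<Suc k}. f ((q @ [w]) ! j) ((q @ [w]) ! l))
       = (\<Prod>j<k. \<Prod>l\<in>{j<..<k}. f (q ! j) (q ! l)) * (\<Prod>j<k. f (q ! j) w)"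
proof -
  have "(\<Prod>j<k. \<Prod>l\<in>{j<..<Suc k}. f ((q @ [w]) ! j) ((q @ [w]) ! l))
      = (\<Prod>j<k. (\<Prod>l\<in>{j<..<k}. f (q ! j) (q ! l)) * f (q ! j) w)"
  proof (rule prod.cong[OF refl])
    fix j
    assume "j \<in> {..<k}"
    then have j: "j < k"
      by simp
    have "{j<..<Suc k} = insert k {j<..<k}"
      using j by auto
    moreover have "(\<Prod>l\<in>{j<..<k}. f ((q @ [w]) ! j) ((q @ [w]) ! l)) = (\<Prod>l\<in>{j<..<k}. f (q ! j) (q ! l))"
      using j q by (intro prod.cong refl) (auto simp: nth_append_left)
    ultimately show "(\<Prod>l\<in>{j<..<Suc k}. f ((q @ [w]) ! j) ((q @ [w]) ! l)) =
        (\<Prod>l\<in>{j<..<k}. f (q ! j) (q ! l)) * f (q ! j) w"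
      using j q by (simp add: nth_append mult.commute)
  qed
  moreover have "{k<..<Suc k} = ({} :: nat set)"
    by auto
  ultimately show ?thesis
    by (simp only: prod.lessThan_Suc prod.distrib prod.empty mult_1_right)
qed

lemma reduced_prefactor_snoc:
  assumes q: "length q = k"
  shows "reduced_prefactor t \<Delta> N r (Suc k) (q @ [w]) = reduced_prefactor t \<Delta> N r k q *
    ((\<Prod>j<k. (t ^ 2 - 2 * \<Delta> * t + q ! j) * (1 / cross_factor t \<Delta> (q ! j) w)) * (1 / w powi (int N - r)))"
proof -
  define A where "A = t ^ 2 - 2 * \<Delta> * t"
  define e where "e = int N - r"
  have "(\<Prod>j<k. (A + (q @ [w]) ! j) ^ (Suc k - 1 - j) / ((q @ [w]) ! j) powi e)
       = (\<Prod>j<k. (A + q ! j) * ((A + q ! j) ^ (k - 1 - j) / (q ! j) powi e))"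
  proof (rule prod.cong[OF refl])
    fix j
    assume "j \<in> {..<k}"
    then have j: "j < k"
      by simp
    then have "Suc k - 1 - j = Suc (k - 1 - j)"
      by simp
    then show "(A + (q @ [w]) ! j) ^ (Suc k - 1 - j) / ((q @ [w]) ! j) powi e =
        (A + q ! j) * ((A + q ! j) ^ (k - 1 - j) / (q ! j) powi e)"
      using j q by (simp only: nth_append_left power_Suc times_divide_eq_right)
  qed
  moreover have "(A + (q @ [w]) ! k) ^ (Suc k - 1 - k) / ((q @ [w]) ! k) powi e = 1 / w powi e"
    using q by auto
  ultimately have "(\<Prod>j<Suc k. (A + (q @ [w]) ! j) ^ (Suc k - 1 - j) / ((q @ [w]) ! j) powi e)
       = (\<Prod>j<k. (A + q ! j) * ((A + q ! j) ^ (k - 1 - j) / (q ! j) powi e)) * (1 / w powi e)"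
    by (simp only: prod.lessThan_Suc)
  moreover note prod_pairs_snoc[OF q, of "\<lambda>a b. 1 / cross_factor t \<Delta> a b" w]
  ultimately show ?thesis
    unfolding reduced_prefactor_def A_def[symmetric] e_def[symmetric] by (simp only: prod.distrib mult_ac)
qed

lemma det_residue_mat_snoc:
  assumes q: "length q = k"
  shows "Determinant.det (residue_mat Hs N (Suc k) (q @ [w])) =
    (\<Sum>i<Suc k. (w - 1) ^ (k - i) * w ^ i * Hs (N - i) w * cofactor (residue_mat Hs N (Suc k) (q @ [1])) i k) / (w - 1)"
proof -
  have E: "residue_mat Hs N (Suc k) (q @ [w]) \<in> carrier_mat (Suc k) (Suc k)"
    by (simp add: residue_mat_def)
  have "cofactor (residue_mat Hs N (Suc k) (q @ [w])) i k = cofactor (residue_mat Hs N (Suc k) (q @ [1])) i k" for i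
  proof -
    have "mat_delete (residue_mat Hs N (Suc k) (q @ [w])) i k = mat_delete (residue_mat Hs N (Suc k) (q @ [1])) i k"
      by (rule eq_matI) (use q in \<open>auto simp: mat_delete_def residue_mat_def nth_append\<close>)
    then show ?thesis
      by (simp add: cofactor_def)
  qed
  moreover have "residue_mat Hs N (Suc k) (q @ [w]) $$ (i, k) = (w - 1) ^ (k - i) * w ^ i * Hs (N - i) w / (w - 1)"
    if "i < Suc k" for i
    using q that by (simp add: residue_mat_def nth_append)
  ultimately show ?thesis
    unfolding laplace_expansion_column[OF E lessI] sum_divide_distrib by (intro sum.cong) auto
qed

lemma cofactor_residue_mat_snoc_1:
  assumes q: "length q = k" and q1: "1 \<notin> set q"
  shows "cofactor (residue_mat Hs N (Suc k) (q @ [1])) k k = Determinant.det (residue_mat Hs N k q)"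
proof -
  have "mat_delete (residue_mat Hs N (Suc k) (q @ [1])) k k = residue_mat Hs N k q"
  proof (rule eq_matI)
    fix i j
    assume "i < dim_row (residue_mat Hs N k q)" "j < dim_col (residue_mat Hs N k q)"
    then have i: "i < k" and j: "j < k"
      by (auto simp: residue_mat_def)
    have qj1: "q ! j - 1 \<noteq> 0"
      using q1 q j by (metis eq_iff_diff_eq_0 nth_mem)
    have "k - i = Suc (k - Suc i)" "Suc k - j = Suc (k - j)"
      using i j by simp_all
    then show "mat_delete (residue_mat Hs N (Suc k) (q @ [1])) k k $$ (i, j) = residue_mat Hs N k q $$ (i, j)"
      using i j q unfolding mat_delete_def residue_mat_def
      by (simp add: nth_append_left mult.assoc del: power_Suc)
         (simp only: power_Suc mult.assoc mult_divide_mult_cancel_left[OF qj1])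
  qed (auto simp: residue_mat_def mat_delete_def)
  then show ?thesis
    by (simp add: cofactor_def)
qed

lemma residue_reduced_integrand:
  assumes \<rho>: "0 < \<rho>" "\<rho> \<le> 1/2"
    and cross: "\<And>a b. a \<in> ball 1 \<rho> \<Longrightarrow> b \<in> ball 1 \<rho> \<Longrightarrow> cross_factor t \<Delta> a b \<noteq> 0"
    and holH: "\<And>i. i \<le> k \<Longrightarrow> Hs (N - i) holomorphic_on ball 1 \<rho>"
    and H1: "Hs (N - k) 1 = 1"
    and q: "length q = k" "set q \<subseteq> ball 1 \<rho> - {1}"
  shows "residue (\<lambda>w. reduced_integrand t \<Delta> Hs N r (Suc k) (q @ [w])) 1 = reduced_integrand t \<Delta> Hs N r k q"
proof -
  define \<Psi> where "\<Psi> w = (\<Prod>j<k. (t ^ 2 - 2 * \<Delta> * t + q ! j) * (1 / cross_factor t \<Delta> (q ! j) w)) *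
    (1 / w powi (int N - r))" for w
  define C where "C i = cofactor (residue_mat Hs N (Suc k) (q @ [1])) i k" for i
  define S where "S w = (\<Sum>i<Suc k. (w - 1) ^ (k - i) * w ^ i * Hs (N - i) w * C i)" for w
  define g where "g w = reduced_prefactor t \<Delta> N r k q * \<Psi> w * S w" for w
  have qj: "q ! j \<in> ball 1 \<rho>" if "j < k" for j
    using q that nth_mem by blast
  have 1: "1 \<in> ball (1::complex) \<rho>"
    using \<rho> by simp
  have "reduced_integrand t \<Delta> Hs N r (Suc k) (q @ [w]) = g w / (w - 1)" for w
    unfolding reduced_integrand_def reduced_prefactor_snoc[OF q(1)] det_residue_mat_snoc[OF q(1)] g_def \<Psi>_def
      S_def C_def by simp
  then have "residue (\<lambda>w. reduced_integrand t \<Delta> Hs N r (Suc k) (q @ [w])) 1 = residue (\<lambda>w. g w / (w - 1)) 1"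
    by simp
  also have "\<dots> = g 1"
  proof (rule residue_simple[OF open_ball 1])
    have "w \<noteq> 0" if "w \<in> ball 1 \<rho>" for w :: complex
      using that \<rho> by (auto simp: dist_norm)
    moreover have "cross_factor t \<Delta> (q ! j) w \<noteq> 0" if "j < k" "w \<in> ball 1 \<rho>" for j w
      using cross qj that by blast
    ultimately show "g holomorphic_on ball 1 \<rho>"
      unfolding g_def \<Psi>_def S_def cross_factor_def by (intro holomorphic_intros holH) auto
  qed
  also have "\<dots> = reduced_prefactor t \<Delta> N r k q * C k"
  proof -
    have "(\<Sum>i<k. (1 - 1) ^ (k - i) * 1 ^ i * Hs (N - i) 1 * C i) = (0::complex)"
      by (intro sum.neutral) auto
    then have "S 1 = C k"
      unfolding S_def by (simp add: H1)
    moreover have "\<Psi> 1 = 1"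
    proof -
      have "cross_factor t \<Delta> (q ! j) 1 = t ^ 2 - 2 * \<Delta> * t + q ! j" "cross_factor t \<Delta> (q ! j) 1 \<noteq> 0"
        if "j < k" for j
        using cross[OF qj[OF that] 1] by (simp_all add: cross_factor_def)
      then show ?thesis
        unfolding \<Psi>_def by (simp add: prod.neutral)
    qed
    ultimately show ?thesis
      by (simp add: g_def)
  qed
  also have "\<dots> = reduced_integrand t \<Delta> Hs N r k q"
  proof -
    have "1 \<notin> set q"
      using q(2) by blast
    then show ?thesis
      unfolding C_def reduced_integrand_def by (simp add: cofactor_residue_mat_snoc_1[OF q(1)])
  qed
  finally show ?thesis .
qed

lemma iter_res_reduced_integrand:
  assumes \<rho>: "0 < \<rho>" "\<rho> \<le> 1/2"
    and cross: "\<And>a b. a \<in> ball 1 \<rho> \<Longrightarrow> b \<in> ball 1 \<rho> \<Longrightarrow> cross_factor t \<Delta> a b \<noteq> 0"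
    and holH: "\<And>i. i < s \<Longrightarrow> Hs (N - i) holomorphic_on ball 1 \<rho>"
    and H1: "\<And>i. i < s \<Longrightarrow> Hs (N - i) 1 = 1"
  shows "k \<le> s \<Longrightarrow> iter_res k (reduced_integrand t \<Delta> Hs N r k) [] = 1"
proof (induction k)
  case 0
  then show ?case
    by (simp add: reduced_integrand_def reduced_prefactor_def residue_mat_def)
next
  case (Suc k)
  have "iter_res (Suc k) (reduced_integrand t \<Delta> Hs N r (Suc k)) [] =
      iter_res k (\<lambda>zs. residue (\<lambda>w. reduced_integrand t \<Delta> Hs N r (Suc k) (zs @ [w])) 1) []"
    by simp
  also have "\<dots> = iter_res k (reduced_integrand t \<Delta> Hs N r k) []"
    using Suc.prems by (intro iter_res_cong[OF \<rho>(1)] residue_reduced_integrand[OF \<rho> cross] holH H1) auto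
  also have "\<dots> = 1"
    using Suc by simp
  finally show ?case .
qed

lemma iter_res_Jfun_eq_1:
  assumes \<rho>: "0 < \<rho>" "\<rho> \<le> 1/2"
    and cross: "\<And>a b. a \<in> ball 1 \<rho> \<Longrightarrow> b \<in> ball 1 \<rho> \<Longrightarrow> cross_factor t \<Delta> a b \<noteq> 0"
    and holH: "\<And>i. i < s \<Longrightarrow> Hs (N - i) holomorphic_on ball 1 \<rho>"
    and H1: "\<And>i. i < s \<Longrightarrow> Hs (N - i) 1 = 1"
    and H: "\<And>i z. i < s \<Longrightarrow> z \<in> ball 1 \<rho> \<Longrightarrow> z \<noteq> 1 \<Longrightarrow> Hs (N - i) z = htilde t \<Delta> (N - i) z"
  shows "iter_res s (Jfun t \<Delta> N r s) [] = 1"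
proof -
  have "Jfun t \<Delta> N r s q = reduced_integrand t \<Delta> Hs N r s q"
    if q: "length q = s" "set q \<subseteq> ball 1 \<rho> - {1}" "distinct q" for q
    using q by (intro Jfun_eq_reduced_integrand H) (auto dest: nth_mem)
  then have "iter_res s (Jfun t \<Delta> N r s) [] = iter_res s (reduced_integrand t \<Delta> Hs N r s) []"
    by (rule iter_res_cong[OF \<rho>(1)])
  also have "\<dots> = 1"
    using iter_res_reduced_integrand[where Hs = Hs and N = N and s = s, OF \<rho> cross holH H1] by simp
  finally show ?thesis .
qed

section \<open>Generic parameters\<close>

lemma cross_factor_nonzero_near_1:
  assumes nz: "t ^ 2 - 2 * \<Delta> * t + 1 \<noteq> 0"
  obtains \<rho> where "0 < \<rho>" "\<rho> \<le> 1/2"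
    "\<And>a b. a \<in> ball 1 \<rho> \<Longrightarrow> b \<in> ball 1 \<rho> \<Longrightarrow> cross_factor t \<Delta> a b \<noteq> 0"
proof -
  define K where "K = cmod (t ^ 2 - 2 * \<Delta> * t + 1)"
  define M where "M = 2 + cmod (1 - 2 * \<Delta> * t)"
  have K: "K > 0"
    using nz by (simp add: K_def)
  have M: "M \<ge> 2"
    by (simp add: M_def)
  define \<rho> where "\<rho> = min (1/2) (K / (2 * M))"
  have \<rho>: "\<rho> > 0" "\<rho> \<le> 1/2"
    using K M by (auto simp: \<rho>_def)
  have "\<rho> * M \<le> K / (2 * M) * M"
    using M by (intro mult_right_mono) (auto simp: \<rho>_def)
  then have \<rho>M: "\<rho> * M \<le> K / 2"
    using M by simp
  have "cross_factor t \<Delta> a b \<noteq> 0" if a: "a \<in> ball 1 \<rho>" and b: "b \<in> ball 1 \<rho>" for a b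
  proof
    assume "cross_factor t \<Delta> a b = 0"
    moreover have "cross_factor t \<Delta> a b = (t ^ 2 - 2 * \<Delta> * t + 1) + ((a - 1) * b + (1 - 2 * \<Delta> * t) * (b - 1))"
      by (simp add: cross_factor_def algebra_simps power2_eq_square)
    ultimately have "K = cmod ((a - 1) * b + (1 - 2 * \<Delta> * t) * (b - 1))"
      unfolding K_def by (metis add_eq_0_iff norm_minus_cancel)
    also have "\<dots> \<le> cmod (a - 1) * cmod b + cmod (1 - 2 * \<Delta> * t) * cmod (b - 1)"
      by (metis norm_mult norm_triangle_ineq)
    also have "\<dots> \<le> \<rho> * 2 + cmod (1 - 2 * \<Delta> * t) * \<rho>"
    proof -
      have "cmod (a - 1) < \<rho>" "cmod (b - 1) < \<rho>"
        using a b by (auto simp: dist_norm norm_minus_commute)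
      moreover have "cmod b \<le> 2"
        using norm_triangle_ineq[of "b - 1" 1] \<open>cmod (b - 1) < \<rho>\<close> \<rho>(2) by simp
      ultimately show ?thesis
        using \<rho>(1) by (intro add_mono mult_mono mult_left_mono) auto
    qed
    also have "\<dots> = \<rho> * M"
      by (simp add: M_def algebra_simps)
    finally show False
      using \<rho>M K by simp
  qed
  with \<rho> that show ?thesis
    by blast
qed

text \<open>Clearing the powers of \<open>t\<close> turns the Hankel determinant into a polynomial in \<open>(\<Delta>, t)\<close>.\<close>
definition hankel_numerator_det :: "nat \<Rightarrow> complex \<Rightarrow> complex \<Rightarrow> complex" where
  "hankel_numerator_det n \<Delta> t = Determinant.det (Matrix.mat n n (\<lambda>(i, j). poly (phi_numerator \<Delta> (i + j)) t))"

lemma hankel_numerator_det_eq: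
  assumes "t \<noteq> 0"
  shows "hankel_numerator_det n \<Delta> t = (\<Prod>i<n. t ^ i) * (\<Prod>j<n. t ^ j) * Determinant.det (hankel_mat t \<Delta> n)"
proof -
  have "Matrix.mat n n (\<lambda>(i, j). poly (phi_numerator \<Delta> (i + j)) t) =
      Matrix.mat n n (\<lambda>(i, j). t ^ i * t ^ j * phi \<Delta> (i + j) t)"
    by (rule eq_matI) (auto simp: poly_phi_numerator[OF assms] power_add)
  then show ?thesis
    unfolding hankel_numerator_det_def hankel_mat_def by (simp only: det_mat_mult_rows_cols)
qed

lemma bipoly_fun_hankel_numerator_det: "bipoly_fun (hankel_numerator_det n)"
  unfolding hankel_numerator_det_def[abs_def] by (intro bipoly_fun_det bipoly_fun_phi_numerator)

lemma hankel_numerator_det_at_0: "hankel_numerator_det n 0 0 \<noteq> 0"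
proof -
  have "Matrix.mat n n (\<lambda>(i, j). poly (phi_numerator 0 (i + j)) 0) =
      Matrix.mat n n (\<lambda>(i, j). (-1) ^ (i + j) * fact (i + j) :: complex)"
    by (rule eq_matI) (auto simp: poly_phi_numerator_0)
  then show ?thesis
    unfolding hankel_numerator_det_def using det_mat_signed_fact_nonzero by simp
qed

lemma generic_parameters:
  "\<exists>P :: complex poly poly. P \<noteq> 0 \<and> (\<forall>t \<Delta>. poly (poly P [:\<Delta>:]) t \<noteq> 0 \<longrightarrow>
     t \<noteq> 0 \<and> t ^ 2 - 2 * \<Delta> * t + 1 \<noteq> 0 \<and> (\<forall>n\<in>{1..N}. Determinant.det (hankel_mat t \<Delta> n) \<noteq> 0))"
proof -
  have "\<exists>P :: complex poly poly. P \<noteq> 0 \<and> (\<forall>\<Delta> t. poly (poly P [:\<Delta>:]) t = hankel_numerator_det n \<Delta> t)" for n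
  proof -
    obtain P :: "complex poly poly" where P: "\<And>\<Delta> t. poly (poly P [:\<Delta>:]) t = hankel_numerator_det n \<Delta> t"
      using bipoly_fun_hankel_numerator_det[of n] unfolding bipoly_fun_def by blast
    moreover have "P \<noteq> 0"
      using P[of 0 0] hankel_numerator_det_at_0[of n] by auto
    ultimately show ?thesis
      by blast
  qed
  then obtain P where P: "\<And>n. P n \<noteq> 0" "\<And>n \<Delta> t. poly (poly (P n) [:\<Delta>:]) t = hankel_numerator_det n \<Delta> t"
    by metis
  define Q1 :: "complex poly poly" where "Q1 = [:[:0, 1:]:]"
  define Q2 :: "complex poly poly" where "Q2 = [:[:1, 0, 1:], [:0, -2:]:]"
  have Q1: "poly (poly Q1 [:\<Delta>:]) t = t" for \<Delta> t
    by (simp add: Q1_def)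
  have Q2: "poly (poly Q2 [:\<Delta>:]) t = t ^ 2 - 2 * \<Delta> * t + 1" for \<Delta> t
    by (simp add: Q2_def algebra_simps power2_eq_square)
  define Q where "Q = Q1 * Q2 * (\<Prod>n\<in>{1..N}. P n)"
  have "Q1 \<noteq> 0" "Q2 \<noteq> 0"
    by (simp_all add: Q1_def Q2_def)
  then have "Q \<noteq> 0"
    using P(1) by (simp add: Q_def)
  moreover have "t \<noteq> 0 \<and> t ^ 2 - 2 * \<Delta> * t + 1 \<noteq> 0 \<and> (\<forall>n\<in>{1..N}. Determinant.det (hankel_mat t \<Delta> n) \<noteq> 0)"
    if "poly (poly Q [:\<Delta>:]) t \<noteq> 0" for t \<Delta>
  proof -
    have "t * (t ^ 2 - 2 * \<Delta> * t + 1) * (\<Prod>n\<in>{1..N}. hankel_numerator_det n \<Delta> t) \<noteq> 0"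
      using that by (simp add: Q_def poly_prod Q1 Q2 P(2))
    then show ?thesis
      using hankel_numerator_det_eq[of t] by auto
  qed
  ultimately show ?thesis
    by blast
qed

lemma htilde_holomorphic_extensions:
  assumes t: "t \<noteq> 0" and c: "t ^ 2 - 2 * \<Delta> * t + 1 \<noteq> 0"
    and B: "\<And>n. n \<in> {1..N} \<Longrightarrow> Determinant.det (hankel_mat t \<Delta> n) \<noteq> 0"
  obtains \<rho>s Hs where "\<forall>n\<in>{1..N}. \<rho>s n > 0 \<and> Hs n holomorphic_on ball 1 (\<rho>s n) \<and> Hs n 1 = 1 \<and>
      (\<forall>z\<in>ball 1 (\<rho>s n). z \<noteq> 1 \<longrightarrow> htilde t \<Delta> n z = Hs n z)"
proof -
  have "t * (t - 2 * \<Delta> + inverse t) = t ^ 2 - 2 * \<Delta> * t + 1"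
    using t by (simp add: algebra_simps power2_eq_square)
  then have "t - 2 * \<Delta> + inverse t \<noteq> 0"
    using c by auto
  then have "\<forall>n\<in>{1..N}. \<exists>\<rho>>0. \<exists>H. H holomorphic_on ball 1 \<rho> \<and> H 1 = 1 \<and>
      (\<forall>z\<in>ball 1 \<rho>. z \<noteq> 1 \<longrightarrow> htilde t \<Delta> n z = H z)"
    using htilde_holomorphic_extension[OF t] B by auto
  then obtain \<rho>s where \<rho>s: "\<forall>n\<in>{1..N}. \<rho>s n > 0 \<and> (\<exists>H. H holomorphic_on ball 1 (\<rho>s n) \<and> H 1 = 1 \<and>
      (\<forall>z\<in>ball 1 (\<rho>s n). z \<noteq> 1 \<longrightarrow> htilde t \<Delta> n z = H z))"
    by (metis (no_types, lifting) bchoice)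
  then obtain Hs where "\<forall>n\<in>{1..N}. Hs n holomorphic_on ball 1 (\<rho>s n) \<and> Hs n 1 = 1 \<and>
      (\<forall>z\<in>ball 1 (\<rho>s n). z \<noteq> 1 \<longrightarrow> htilde t \<Delta> n z = Hs n z)"
    by (metis (no_types, lifting) bchoice)
  with \<rho>s that show ?thesis
    by blast
qed

lemma htilde_common_extensions:
  assumes t: "t \<noteq> 0" and c: "t ^ 2 - 2 * \<Delta> * t + 1 \<noteq> 0"
    and B: "\<And>n. n \<in> {1..N} \<Longrightarrow> Determinant.det (hankel_mat t \<Delta> n) \<noteq> 0"
  obtains \<rho> Hs where "0 < \<rho>" "\<rho> \<le> 1/2"
    "\<And>a b. a \<in> ball 1 \<rho> \<Longrightarrow> b \<in> ball 1 \<rho> \<Longrightarrow> cross_factor t \<Delta> a b \<noteq> 0"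
    "\<And>n. n \<in> {1..N} \<Longrightarrow> Hs n holomorphic_on ball 1 \<rho>" "\<And>n. n \<in> {1..N} \<Longrightarrow> Hs n 1 = 1"
    "\<And>n z. n \<in> {1..N} \<Longrightarrow> z \<in> ball 1 \<rho> \<Longrightarrow> z \<noteq> 1 \<Longrightarrow> Hs n z = htilde t \<Delta> n z"
proof -
  obtain \<rho>s Hs where Hs: "\<forall>n\<in>{1..N}. \<rho>s n > 0 \<and> Hs n holomorphic_on ball 1 (\<rho>s n) \<and> Hs n 1 = 1 \<and>
      (\<forall>z\<in>ball 1 (\<rho>s n). z \<noteq> 1 \<longrightarrow> htilde t \<Delta> n z = Hs n z)"
    using htilde_holomorphic_extensions[OF t c B] by blast
  have \<rho>s: "\<rho>s n > 0" if "n \<in> {1..N}" for n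
    using Hs that by blast
  obtain \<rho>c where \<rho>c: "0 < \<rho>c" "\<rho>c \<le> 1/2"
    and cross: "\<And>a b. a \<in> ball 1 \<rho>c \<Longrightarrow> b \<in> ball 1 \<rho>c \<Longrightarrow> cross_factor t \<Delta> a b \<noteq> 0"
    using cross_factor_nonzero_near_1[OF c] by blast
  define \<rho> where "\<rho> = Min (insert \<rho>c (\<rho>s ` {1..N}))"
  have \<rho>: "0 < \<rho>" "\<rho> \<le> \<rho>c"
    using \<rho>c \<rho>s by (auto simp: \<rho>_def)
  have "\<rho> \<le> \<rho>s n" if "n \<in> {1..N}" for n
    unfolding \<rho>_def by (rule Min_le) (use that in auto)
  then have ball: "ball 1 \<rho> \<subseteq> ball 1 \<rho>c" "\<And>n. n \<in> {1..N} \<Longrightarrow> ball 1 \<rho> \<subseteq> ball 1 (\<rho>s n)"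
    using \<rho>(2) by (simp_all add: subset_ball)
  show ?thesis
  proof
    show "0 < \<rho>" "\<rho> \<le> 1/2"
      using \<rho> \<rho>c by auto
    show "cross_factor t \<Delta> a b \<noteq> 0" if "a \<in> ball 1 \<rho>" "b \<in> ball 1 \<rho>" for a b
      using cross ball that by blast
    show "Hs n holomorphic_on ball 1 \<rho>" if "n \<in> {1..N}" for n
    proof -
      have "Hs n holomorphic_on ball 1 (\<rho>s n)"
        using Hs that by blast
      then show ?thesis
        using ball(2)[OF that] by (rule holomorphic_on_subset)
    qed
    show "Hs n 1 = 1" if "n \<in> {1..N}" for n
      using Hs that by blast
    show "Hs n z = htilde t \<Delta> n z" if "n \<in> {1..N}" "z \<in> ball 1 \<rho>" "z \<noteq> 1" for n z
    proof -
      have "z \<in> ball 1 (\<rho>s n)"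
        using ball(2)[OF that(1)] that(2) by blast
      then show ?thesis
        using Hs that(1,3) by metis
    qed
  qed
qed

lemma iter_res_Jfun_eq_1_if_generic:
  assumes s: "s \<le> N" and t: "t \<noteq> 0" and c: "t ^ 2 - 2 * \<Delta> * t + 1 \<noteq> 0"
    and B: "\<And>n. n \<in> {1..N} \<Longrightarrow> Determinant.det (hankel_mat t \<Delta> n) \<noteq> 0"
  shows "iter_res s (Jfun t \<Delta> N r s) [] = 1"
proof (rule htilde_common_extensions[OF t c B])
  fix \<rho> :: real and Hs
  assume \<rho>: "0 < \<rho>" "\<rho> \<le> 1/2"
    and cross: "\<And>a b. a \<in> ball 1 \<rho> \<Longrightarrow> b \<in> ball 1 \<rho> \<Longrightarrow> cross_factor t \<Delta> a b \<noteq> 0"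
    and holH: "\<And>n. n \<in> {1..N} \<Longrightarrow> Hs n holomorphic_on ball 1 \<rho>"
    and H1: "\<And>n. n \<in> {1..N} \<Longrightarrow> Hs n 1 = 1"
    and H: "\<And>n z. n \<in> {1..N} \<Longrightarrow> z \<in> ball 1 \<rho> \<Longrightarrow> z \<noteq> 1 \<Longrightarrow> Hs n z = htilde t \<Delta> n z"
  have "N - i \<in> {1..N}" if "i < s" for i
    using that s by auto
  then show "iter_res s (Jfun t \<Delta> N r s) [] = 1"
    by (intro iter_res_Jfun_eq_1[where Hs = Hs, OF \<rho> cross] holH H1 H)
qed

theorem lemma1:
  fixes N s :: nat and r :: int
  assumes "1 \<le> N" and "1 \<le> s" and "s \<le> N"
  shows "\<exists>P :: complex poly poly. P \<noteq> 0 \<and>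
           (\<forall>t \<Delta> :: complex. poly (poly P [:\<Delta>:]) t \<noteq> 0 \<longrightarrow>
              iter_res s (Jfun t \<Delta> N r s) [] = 1)"
proof -
  obtain P :: "complex poly poly" where "P \<noteq> 0" and P: "\<And>t \<Delta>. poly (poly P [:\<Delta>:]) t \<noteq> 0 \<Longrightarrow>
      t \<noteq> 0 \<and> t ^ 2 - 2 * \<Delta> * t + 1 \<noteq> 0 \<and> (\<forall>n\<in>{1..N}. Determinant.det (hankel_mat t \<Delta> n) \<noteq> 0)"
    using generic_parameters[of N] by blast
  moreover have "iter_res s (Jfun t \<Delta> N r s) [] = 1" if "poly (poly P [:\<Delta>:]) t \<noteq> 0" for t \<Delta>
    using P[OF that] \<open>s \<le> N\<close> by (intro iter_res_Jfun_eq_1_if_generic) auto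
  ultimately show ?thesis
    by blast
qed

end
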